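(* Let $\Phi=(A;E_0,\ldots,E_d;A^*;E^*_0,\ldots,E^*_d)$ be a Leonard system in $\mathcal A$ over $\mathbb K$, with eigenvalue sequence $\theta_0,\ldots,\theta_d$ and dual eigenvalue sequence $\theta^*_0,\ldots,\theta^*_d$, and let $V$ be the irreducible left $\mathcal A$-module. Let $\eta_0,\eta_d,\eta^*_0,\eta^*_d$ be nonzero vectors in $V$ with $\eta_0\in E_0V$, $\eta_d\in E_dV$, $\eta^*_0\in E^*_0V$, $\eta^*_d\in E^*_dV$. For each of the 24 linear orderings $g$ of $\{0,d,0^*,d^*\}$ consider the corresponding line of the list below. Then for $0\le i\le d$ the vector $v_i$ given in that line is a basis for the (one-dimensional) subspace of $V$ given after it, and the sequence $v_0,v_1,\ldots,v_d$ is a basis for $V$. (A scalar in the product stands for that scalar times $I$, and empty products equal $I$.) (1) Subspace $(E^*_0V+\cdots+E^*_iV)\cap(E_iV+\cdots+E_dV)$: $g=d^*00^*d$: $v_i=(A-\theta_0)\cdots(A-\theta_{i-1})\eta^*_0$; $g=0d^*0^*d$: $v_i=(A^*-\theta^*_d)\cdots(A^*-\theta^*_{i+1})\eta_d$. (2) Subspace $(E^*_0V+\cdots+E^*_{d-i}V)\cap(E_{d-i}V+\cdots+E_dV)$: $g=d^*0d0^*$: $v_i=(A-\theta_0)\cdots(A-\theta_{d-i-1})\eta^*_0$; $g=0d^*d0^*$: $v_i=(A^*-\theta^*_d)\cdots(A^*-\theta^*_{d-i+1})\eta_d$. (3) Subspace $(E_0V+\cdots+E_iV)\cap(E^*_iV+\cdots+E^*_dV)$: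 $g=d0^*0d^*$: $v_i=(A^*-\theta^*_0)\cdots(A^*-\theta^*_{i-1})\eta_0$; $g=0^*d0d^*$: $v_i=(A-\theta_d)\cdots(A-\theta_{i+1})\eta^*_d$. (4) Subspace $(E_0V+\cdots+E_{d-i}V)\cap(E^*_{d-i}V+\cdots+E^*_dV)$: $g=d0^*d^*0$: $v_i=(A^*-\theta^*_0)\cdots(A^*-\theta^*_{d-i-1})\eta_0$; $g=0^*dd^*0$: $v_i=(A-\theta_d)\cdots(A-\theta_{d-i+1})\eta^*_d$. (5) Subspace $(E_0V+\cdots+E_iV)\cap(E^*_{d-i}V+\cdots+E^*_0V)$: $g=dd^*00^*$: $v_i=(A^*-\theta^*_d)\cdots(A^*-\theta^*_{d-i+1})\eta_0$; $g=d^*d00^*$: $v_i=(A-\theta_d)\cdots(A-\theta_{i+1})\eta^*_0$. (6) Subspace $(E_0V+\cdots+E_{d-i}V)\cap(E^*_iV+\cdots+E^*_0V)$: $g=dd^*0^*0$: $v_i=(A^*-\theta^*_d)\cdots(A^*-\theta^*_{i+1})\eta_0$; $g=d^*d0^*0$: $v_i=(A-\theta_d)\cdots(A-\theta_{d-i+1})\eta^*_0$. (7) Subspace $(E_dV+\cdots+E_{d-i}V)\cap(E^*_iV+\cdots+E^*_dV)$: $g=00^*dd^*$: $v_i=(A^*-\theta^*_0)\cdots(A^*-\theta^*_{i-1})\eta_d$; $g=0^*0dd^*$: $v_i=(A-\theta_0)\cdots(A-\theta_{d-i-1})\eta^*_d$. (8) Subspace $(E_dV+\cdots+E_iV)\cap(E^*_{d-i}V+\cdots+E^*_dV)$: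 $g=00^*d^*d$: $v_i=(A^*-\theta^*_0)\cdots(A^*-\theta^*_{d-i-1})\eta_d$; $g=0^*0d^*d$: $v_i=(A-\theta_0)\cdots(A-\theta_{i-1})\eta^*_d$. (9) Subspace $E_iV$: $g=d^*0^*0d$: $v_i=E_i\eta^*_0$; $g=0^*d^*0d$: $v_i=E_i\eta^*_d$. (10) Subspace $E_{d-i}V$: $g=d^*0^*d0$: $v_i=E_{d-i}\eta^*_0$; $g=0^*d^*d0$: $v_i=E_{d-i}\eta^*_d$. (11) Subspace $E^*_iV$: $g=d00^*d^*$: $v_i=E^*_i\eta_0$; $g=0d0^*d^*$: $v_i=E^*_i\eta_d$. (12) Subspace $E^*_{d-i}V$: $g=d0d^*0^*$: $v_i=E^*_{d-i}\eta_0$; $g=0dd^*0^*$: $v_i=E^*_{d-i}\eta_d$.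
   Context: Let $\mathbb K$ be an arbitrary field and $d\ge 0$ an integer. $\mathrm{Mat}_{d+1}(\mathbb K)$ is the $\mathbb K$-algebra of $(d+1)\times(d+1)$ matrices over $\mathbb K$, rows and columns indexed by $0,1,\ldots,d$; $\mathcal A$ is a $\mathbb K$-algebra isomorphic to it, with identity $I$. An element of $\mathcal A$ is multiplicity-free if it has $d+1$ distinct eigenvalues (roots of its minimal polynomial), all in $\mathbb K$. If $X\in\mathcal A$ is multiplicity-free with eigenvalues $\xi_0,\ldots,\xi_d$, the primitive idempotent of $X$ associated with $\xi_i$ is $\prod_{j\ne i}(X-\xi_jI)/(\xi_i-\xi_j)$. A Leonard system in $\mathcal A$ is a sequence $\Phi=(A;E_0,\ldots,E_d;A^*;E^*_0,\ldots,E^*_d)$ such that: (i) $A,A^*\in\mathcal A$ are both multiplicity-free; (ii) $E_0,\ldots,E_d$ is an ordering of the primitive idempotents of $A$; (iii) $E^*_0,\ldots,E^*_d$ is an ordering of the primitive idempotents of $A^*$; (iv) $E_iA^*E_j$ is $0$ if $|i-j|>1$ and nonzero if $|i-j|=1$; (v) $E^*_iAE^*_j$ is $0$ if $|i-j|>1$ and nonzero if $|i-j|=1$ ($0\le i,j\le d$). ($A^*$ is just a name, not a conjugate-transpose.) $\theta_i$ (resp. $\theta^*_i$) denotes the eigenvalue of $A$ (resp. $A^*$) associated with $E_i$ (resp. $E^*_i$); these form the eigenvalue sequence (resp. dual eigenvalue sequence). The irreducible left $\mathcal A$-module $V$ has dimension $d+1$. The symmetric group $S_4$ is identified with the set of linear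 orderings $wxyz$ of the four symbols $0,d,0^*,d^*$; the basis attached to $g\in S_4$ is denoted $\lbrack g\rbrack$. *)

theory Defs
  imports "Jordan_Normal_Form.Matrix" "HOL-Computational_Algebra.Polynomial" "HOL-Library.Set_Algebras"
begin

text \<open>Associative unital algebras over a field, and those isomorphic to the algebra of
  \<open>(d+1) \<times> (d+1)\<close> matrices (whose rows and columns are indexed from \<open>0\<close>).\<close>

locale field_algebra = vector_space scale
  for scale :: "'k::field \<Rightarrow> 'a::ring_1 \<Rightarrow> 'a" +
  assumes scale_mult_left: "scale c x * y = scale c (x * y)"
    and scale_mult_right: "x * scale c y = scale c (x * y)"

definition matrix_algebra_iso :: "nat \<Rightarrow> ('k::field \<Rightarrow> 'a::ring_1 \<Rightarrow> 'a) \<Rightarrow> ('a \<Rightarrow> 'k mat) \<Rightarrow> bool" where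
  "matrix_algebra_iso n scale \<phi> \<longleftrightarrow>
     bij_betw \<phi> UNIV (carrier_mat n n) \<and>
     (\<forall>x y. \<phi> (x + y) = \<phi> x + \<phi> y) \<and>
     (\<forall>x y. \<phi> (x * y) = \<phi> x * \<phi> y) \<and>
     \<phi> 1 = 1\<^sub>m n \<and>
     (\<forall>c x. \<phi> (scale c x) = c \<cdot>\<^sub>m \<phi> x)"

definition full_matrix_algebra :: "nat \<Rightarrow> ('k::field \<Rightarrow> 'a::ring_1 \<Rightarrow> 'a) \<Rightarrow> bool" where
  "full_matrix_algebra d scale \<longleftrightarrow>
     field_algebra scale \<and> (\<exists>\<phi>. matrix_algebra_iso (d + 1) scale \<phi>)"

text \<open>Left modules over a (non-commutative) ring. The library's \<open>module\<close> locales
  are restricted to commutative rings of scalars.\<close>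

locale left_module =
  fixes act :: "'a::ring_1 \<Rightarrow> 'v::ab_group_add \<Rightarrow> 'v"
  assumes act_add_left: "act (x + y) v = act x v + act y v"
    and act_add_right: "act x (v + w) = act x v + act x w"
    and act_mult: "act (x * y) v = act x (act y v)"
    and act_one: "act 1 v = v"

definition submodule :: "('a::ring_1 \<Rightarrow> 'v::ab_group_add \<Rightarrow> 'v) \<Rightarrow> 'v set \<Rightarrow> bool" where
  "submodule act W \<longleftrightarrow>
     0 \<in> W \<and> (\<forall>v\<in>W. \<forall>w\<in>W. v + w \<in> W) \<and> (\<forall>x. \<forall>v\<in>W. act x v \<in> W)"

definition irreducible_left_module :: "('a::ring_1 \<Rightarrow> 'v::ab_group_add \<Rightarrow> 'v) \<Rightarrow> bool" where
  "irreducible_left_module act \<longleftrightarrow>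
     left_module act \<and> (\<exists>v::'v. v \<noteq> 0) \<and>
     (\<forall>W. submodule act W \<longrightarrow> W = {0} \<or> W = UNIV)"

text \<open>The vector space structure that a module over a \<open>\<bbbK>\<close>-algebra inherits from \<open>\<bbbK> I\<close>.\<close>

definition induced_scale ::
  "('k::field \<Rightarrow> 'a::ring_1 \<Rightarrow> 'a) \<Rightarrow> ('a \<Rightarrow> 'v::ab_group_add \<Rightarrow> 'v) \<Rightarrow> 'k \<Rightarrow> 'v \<Rightarrow> 'v" where
  "induced_scale scale act c v = act (scale c 1) v"

definition is_basis_of :: "('k::field \<Rightarrow> 'v::ab_group_add \<Rightarrow> 'v) \<Rightarrow> 'v set \<Rightarrow> 'v set \<Rightarrow> bool" where
  "is_basis_of s B W \<longleftrightarrow> \<not> module.dependent s B \<and> module.span s B = W"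

text \<open>As \<open>v\<^sub>0, \<dots>, v\<^sub>d\<close> is a sequence, repetitions have to be excluded explicitly.\<close>

definition is_basis_sequence :: "('k::field \<Rightarrow> 'v::ab_group_add \<Rightarrow> 'v) \<Rightarrow> nat \<Rightarrow> (nat \<Rightarrow> 'v) \<Rightarrow> bool" where
  "is_basis_sequence s d v \<longleftrightarrow> inj_on v {0..d} \<and> is_basis_of s (v ` {0..d}) UNIV"

definition alg_poly :: "('k::field \<Rightarrow> 'a::ring_1 \<Rightarrow> 'a) \<Rightarrow> 'k poly \<Rightarrow> 'a \<Rightarrow> 'a" where
  "alg_poly scale p X = (\<Sum>i\<le>degree p. scale (coeff p i) (X ^ i))"

definition min_poly :: "('k::field \<Rightarrow> 'a::ring_1 \<Rightarrow> 'a) \<Rightarrow> 'a \<Rightarrow> 'k poly" where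
  "min_poly scale X = (ARG_MIN degree p. lead_coeff p = 1 \<and> alg_poly scale p X = 0)"

definition eigenvalues :: "('k::field \<Rightarrow> 'a::ring_1 \<Rightarrow> 'a) \<Rightarrow> 'a \<Rightarrow> 'k set" where
  "eigenvalues scale X = {x. poly (min_poly scale X) x = 0}"

text \<open>Only the eigenvalues in \<open>\<bbbK>\<close> are counted. In an algebra isomorphic to the
  \<open>(d+1) \<times> (d+1)\<close> matrices the minimal polynomial has degree at most \<open>d+1\<close>, so if there are
  \<open>d+1\<close> of them there are no others in any extension of \<open>\<bbbK>\<close>.\<close>

definition multiplicity_free :: "nat \<Rightarrow> ('k::field \<Rightarrow> 'a::ring_1 \<Rightarrow> 'a) \<Rightarrow> 'a \<Rightarrow> bool" where
  "multiplicity_free d scale X \<longleftrightarrow> card (eigenvalues scale X) = d + 1"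

text \<open>The factors \<open>(X - \<zeta> I) / (\<xi> - \<zeta>)\<close> commute with each other. Since the library's unordered
  product needs a commutative ring, it is formed among polynomials and evaluated at \<open>X\<close>.\<close>

definition primitive_idempotent :: "('k::field \<Rightarrow> 'a::ring_1 \<Rightarrow> 'a) \<Rightarrow> 'a \<Rightarrow> 'k \<Rightarrow> 'a" where
  "primitive_idempotent scale X \<xi> =
     alg_poly scale (\<Prod>\<zeta>\<in>eigenvalues scale X - {\<xi>}. smult (1 / (\<xi> - \<zeta>)) [:- \<zeta>, 1:]) X"

definition idempotent_ordering ::
  "nat \<Rightarrow> ('k::field \<Rightarrow> 'a::ring_1 \<Rightarrow> 'a) \<Rightarrow> 'a \<Rightarrow> (nat \<Rightarrow> 'a) \<Rightarrow> bool" where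
  "idempotent_ordering d scale X E \<longleftrightarrow>
     bij_betw E {0..d} (primitive_idempotent scale X ` eigenvalues scale X)"

definition tridiagonal_products :: "nat \<Rightarrow> 'a::ring_1 \<Rightarrow> (nat \<Rightarrow> 'a) \<Rightarrow> bool" where
  "tridiagonal_products d X E \<longleftrightarrow>
     (\<forall>i\<le>d. \<forall>j\<le>d.
        (\<bar>int i - int j\<bar> > 1 \<longrightarrow> E i * X * E j = 0) \<and>
        (\<bar>int i - int j\<bar> = 1 \<longrightarrow> E i * X * E j \<noteq> 0))"

definition leonard_system ::
  "nat \<Rightarrow> ('k::field \<Rightarrow> 'a::ring_1 \<Rightarrow> 'a) \<Rightarrow> 'a \<Rightarrow> (nat \<Rightarrow> 'a) \<Rightarrow> 'a \<Rightarrow> (nat \<Rightarrow> 'a) \<Rightarrow> bool" where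
  "leonard_system d scale A E As Es \<longleftrightarrow>
     multiplicity_free d scale A \<and> multiplicity_free d scale As \<and>
     idempotent_ordering d scale A E \<and>
     idempotent_ordering d scale As Es \<and>
     tridiagonal_products d As E \<and>
     tridiagonal_products d A Es"

definition eigenvalue_sequence ::
  "nat \<Rightarrow> ('k::field \<Rightarrow> 'a::ring_1 \<Rightarrow> 'a) \<Rightarrow> 'a \<Rightarrow> (nat \<Rightarrow> 'a) \<Rightarrow> (nat \<Rightarrow> 'k) \<Rightarrow> bool" where
  "eigenvalue_sequence d scale X E \<theta> \<longleftrightarrow>
     (\<forall>i\<le>d. \<theta> i \<in> eigenvalues scale X \<and> E i = primitive_idempotent scale X (\<theta> i))"

text \<open>The products \<open>(X - t\<^sub>0) \<cdots> (X - t\<^sub>m\<^sub>-\<^sub>1)\<close> and \<open>(X - t\<^sub>d) \<cdots> (X - t\<^sub>m\<^sub>+\<^sub>1)\<close>.\<close>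

definition ascending_product ::
  "('k::field \<Rightarrow> 'a::ring_1 \<Rightarrow> 'a) \<Rightarrow> 'a \<Rightarrow> (nat \<Rightarrow> 'k) \<Rightarrow> nat \<Rightarrow> 'a" where
  "ascending_product scale X t m = prod_list (map (\<lambda>h. X - scale (t h) 1) [0..<m])"

definition descending_product ::
  "nat \<Rightarrow> ('k::field \<Rightarrow> 'a::ring_1 \<Rightarrow> 'a) \<Rightarrow> 'a \<Rightarrow> (nat \<Rightarrow> 'k) \<Rightarrow> nat \<Rightarrow> 'a" where
  "descending_product d scale X t m = prod_list (map (\<lambda>h. X - scale (t h) 1) (rev [m + 1..<d + 1]))"

text \<open>The subspace \<open>E\<^sub>m V + \<cdots> + E\<^sub>n V\<close>, as a sum of sets in the sense of
  \<^theory>\<open>HOL-Library.Set_Algebras\<close>.\<close>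

definition idempotent_sum ::
  "('a::ring_1 \<Rightarrow> 'v::ab_group_add \<Rightarrow> 'v) \<Rightarrow> (nat \<Rightarrow> 'a) \<Rightarrow> nat \<Rightarrow> nat \<Rightarrow> 'v set" where
  "idempotent_sum act E m n = (\<Sum>j\<in>{m..n}. range (act (E j)))"

text \<open>The four formal symbols \<open>0, d, 0\<^sup>*, d\<^sup>*\<close>; they stay distinct when \<open>d = 0\<close>.\<close>

datatype flag_symbol = S0 | Sd | S0s | Sds

definition linear_ordering :: "flag_symbol list \<Rightarrow> bool" where
  "linear_ordering g \<longleftrightarrow> distinct g \<and> set g = {S0, Sd, S0s, Sds}"

text \<open>One entry \<open>(g, v, W)\<close> for each linear ordering \<open>g\<close>, where \<open>v i\<close> is the \<open>i\<close>-th vector of the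
  basis \<open>[g]\<close> and \<open>W i\<close> is the subspace it is claimed to span.\<close>

definition basis_table ::
  "nat \<Rightarrow> ('k::field \<Rightarrow> 'a::ring_1 \<Rightarrow> 'a) \<Rightarrow> ('a \<Rightarrow> 'v::ab_group_add \<Rightarrow> 'v) \<Rightarrow>
   'a \<Rightarrow> (nat \<Rightarrow> 'a) \<Rightarrow> 'a \<Rightarrow> (nat \<Rightarrow> 'a) \<Rightarrow> (nat \<Rightarrow> 'k) \<Rightarrow> (nat \<Rightarrow> 'k) \<Rightarrow>
   'v \<Rightarrow> 'v \<Rightarrow> 'v \<Rightarrow> 'v \<Rightarrow> (flag_symbol list \<times> (nat \<Rightarrow> 'v) \<times> (nat \<Rightarrow> 'v set)) list" where
  "basis_table d scale act A E As Es \<theta> \<theta>s \<eta>0 \<eta>d \<eta>s0 \<eta>sd =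
    (let up = ascending_product scale A \<theta>;
         down = descending_product d scale A \<theta>;
         ups = ascending_product scale As \<theta>s;
         downs = descending_product d scale As \<theta>s;
         S = idempotent_sum act E;
         Ss = idempotent_sum act Es
     in
     [([Sds, S0, S0s, Sd], \<lambda>i. act (up i) \<eta>s0,          \<lambda>i. Ss 0 i \<inter> S i d),
      ([S0, Sds, S0s, Sd], \<lambda>i. act (downs i) \<eta>d,        \<lambda>i. Ss 0 i \<inter> S i d),

      ([Sds, S0, Sd, S0s], \<lambda>i. act (up (d - i)) \<eta>s0,    \<lambda>i. Ss 0 (d - i) \<inter> S (d - i) d),
      ([S0, Sds, Sd, S0s], \<lambda>i. act (downs (d - i)) \<eta>d,  \<lambda>i. Ss 0 (d - i) \<inter> S (d - i) d),

      ([Sd, S0s, S0, Sds], \<lambda>i. act (ups i) \<eta>0,          \<lambda>i. S 0 i \<inter> Ss i d),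
      ([S0s, Sd, S0, Sds], \<lambda>i. act (down i) \<eta>sd,        \<lambda>i. S 0 i \<inter> Ss i d),

      ([Sd, S0s, Sds, S0], \<lambda>i. act (ups (d - i)) \<eta>0,    \<lambda>i. S 0 (d - i) \<inter> Ss (d - i) d),
      ([S0s, Sd, Sds, S0], \<lambda>i. act (down (d - i)) \<eta>sd,  \<lambda>i. S 0 (d - i) \<inter> Ss (d - i) d),

      ([Sd, Sds, S0, S0s], \<lambda>i. act (downs (d - i)) \<eta>0,  \<lambda>i. S 0 i \<inter> Ss 0 (d - i)),
      ([Sds, Sd, S0, S0s], \<lambda>i. act (down i) \<eta>s0,        \<lambda>i. S 0 i \<inter> Ss 0 (d - i)),

      ([Sd, Sds, S0s, S0], \<lambda>i. act (downs i) \<eta>0,        \<lambda>i. S 0 (d - i) \<inter> Ss 0 i),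
      ([Sds, Sd, S0s, S0], \<lambda>i. act (down (d - i)) \<eta>s0,  \<lambda>i. S 0 (d - i) \<inter> Ss 0 i),

      ([S0, S0s, Sd, Sds], \<lambda>i. act (ups i) \<eta>d,          \<lambda>i. S (d - i) d \<inter> Ss i d),
      ([S0s, S0, Sd, Sds], \<lambda>i. act (up (d - i)) \<eta>sd,    \<lambda>i. S (d - i) d \<inter> Ss i d),

      ([S0, S0s, Sds, Sd], \<lambda>i. act (ups (d - i)) \<eta>d,    \<lambda>i. S i d \<inter> Ss (d - i) d),
      ([S0s, S0, Sds, Sd], \<lambda>i. act (up i) \<eta>sd,          \<lambda>i. S i d \<inter> Ss (d - i) d),

      ([Sds, S0s, S0, Sd], \<lambda>i. act (E i) \<eta>s0,           \<lambda>i. range (act (E i))),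
      ([S0s, Sds, S0, Sd], \<lambda>i. act (E i) \<eta>sd,           \<lambda>i. range (act (E i))),

      ([Sds, S0s, Sd, S0], \<lambda>i. act (E (d - i)) \<eta>s0,     \<lambda>i. range (act (E (d - i)))),
      ([S0s, Sds, Sd, S0], \<lambda>i. act (E (d - i)) \<eta>sd,     \<lambda>i. range (act (E (d - i)))),

      ([Sd, S0, S0s, Sds], \<lambda>i. act (Es i) \<eta>0,           \<lambda>i. range (act (Es i))),
      ([S0, Sd, S0s, Sds], \<lambda>i. act (Es i) \<eta>d,           \<lambda>i. range (act (Es i))),

      ([Sd, S0, Sds, S0s], \<lambda>i. act (Es (d - i)) \<eta>0,     \<lambda>i. range (act (Es (d - i)))),
      ([S0, Sd, Sds, S0s], \<lambda>i. act (Es (d - i)) \<eta>d,     \<lambda>i. range (act (Es (d - i))))])"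

end

theory Submission
  imports Defs
begin

text \<open>An irreducible module over a full matrix algebra is faithful and spanned by \<open>d + 1\<close> vectors, so
  the \<open>d + 1\<close> eigenvectors of a multiplicity-free element form a basis, and each of its primitive
  idempotents projects onto a line. Put \<open>v\<^sub>i = (A - \<theta>\<^sub>0) \<cdots> (A - \<theta>\<^sub>i\<^sub>-\<^sub>1) \<eta>\<^sup>*\<^sub>0\<close>. Since \<open>A\<close> is irreducible
  tridiagonal with respect to the \<open>E\<^sup>*\<^sub>j\<close>, the vector \<open>v\<^sub>i\<close> lies in \<open>E\<^sup>*\<^sub>0 V + \<cdots> + E\<^sup>*\<^sub>i V\<close> with nonzero
  \<open>E\<^sup>*\<^sub>i\<close>-component, so the \<open>v\<^sub>i\<close> span \<open>V\<close>. Hence \<open>\<eta>\<^sup>*\<^sub>0\<close> is a cyclic vector for \<open>A\<close>, no \<open>E\<^sub>j \<eta>\<^sup>*\<^sub>0\<close>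
  vanishes, and \<open>v\<^sub>i\<close> also has nonzero \<open>E\<^sub>i\<close>-component while lying in \<open>E\<^sub>i V + \<cdots> + E\<^sub>d V\<close>; the two
  opposite triangular shapes make the intersection of the two flags the line through \<open>v\<^sub>i\<close>. The
  remaining bases arise by reversing the order of the \<open>E\<^sub>j\<close>, reversing the order of the \<open>E\<^sup>*\<^sub>j\<close>, and
  interchanging the two families.\<close>

section \<open>Modules over algebras\<close>

locale algebra_module = field_algebra scale + left_module act
  for scale :: "'k::field \<Rightarrow> 'a::ring_1 \<Rightarrow> 'a"
    and act :: "'a \<Rightarrow> 'v::ab_group_add \<Rightarrow> 'v"
begin

abbreviation vscale :: "'k \<Rightarrow> 'v \<Rightarrow> 'v" where
  "vscale \<equiv> induced_scale scale act"

lemma act_scale: "act (scale c x) v = vscale c (act x v)"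
  using scale_mult_left[of c 1 x] by (simp add: induced_scale_def flip: act_mult)

lemma act_zero_left [simp]: "act 0 v = 0"
  using act_add_left[of 0 0 v] by simp

lemma act_zero_right [simp]: "act x 0 = 0"
  using act_add_right[of x 0 0] by simp

lemma act_diff_left: "act (x - y) v = act x v - act y v"
  using act_add_left[of "x - y" y v] by (simp add: algebra_simps)

lemma act_diff_right: "act x (v - w) = act x v - act x w"
  using act_add_right[of x "v - w" w] by (simp add: algebra_simps)

lemma act_sum_left: "act (\<Sum>i\<in>I. f i) v = (\<Sum>i\<in>I. act (f i) v)"
  by (induction I rule: infinite_finite_induct) (simp_all add: act_add_left)

lemma act_sum_right: "act x (\<Sum>i\<in>I. f i) = (\<Sum>i\<in>I. act x (f i))"
  by (induction I rule: infinite_finite_induct) (simp_all add: act_add_right)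

lemma act_vscale: "act x (vscale c v) = vscale c (act x v)"
  using scale_mult_right[of x c 1] by (simp add: induced_scale_def scale_mult_left flip: act_mult)

sublocale V: vector_space vscale
proof
  fix a b x y
  show "vscale a (x + y) = vscale a x + vscale a y"
    by (simp add: induced_scale_def act_add_right)
  show "vscale (a + b) x = vscale a x + vscale b x"
    by (simp add: induced_scale_def scale_left_distrib act_add_left)
  show "vscale a (vscale b x) = vscale (a * b) x"
    by (simp add: induced_scale_def scale_mult_left flip: act_mult)
  show "vscale 1 x = x"
    by (simp add: induced_scale_def act_one)
qed

text \<open>Indexed coefficients give independence and injectivity together: a repetition
  \<open>v i = v j\<close> with distinct indices would allow the nontrivial relation with
  coefficients 1 and -1.\<close>

lemma is_basis_sequenceI:
  assumes indep: "\<And>c. (\<Sum>i\<le>d. vscale (c i) (v i)) = 0 \<Longrightarrow> \<forall>i\<le>d. c i = 0"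
    and span: "\<And>x. x \<in> V.span (v ` {..d})"
  shows "is_basis_sequence vscale d v"
proof -
  have inj: "inj_on v {..d}"
  proof (rule inj_onI)
    fix i j assume ij: "i \<in> {..d}" "j \<in> {..d}" "v i = v j"
    show "i = j"
    proof (rule ccontr)
      assume ne: "i \<noteq> j"
      define c :: "nat \<Rightarrow> 'k" where "c k = (if k = i then 1 else if k = j then - 1 else 0)" for k
      have "(\<Sum>k\<le>d. vscale (c k) (v k)) = (\<Sum>k\<in>{i, j}. vscale (c k) (v k))"
        by (rule sum.mono_neutral_right) (use ij in \<open>auto simp: c_def\<close>)
      also have "\<dots> = 0"
        using ne ij by (simp add: c_def)
      finally have "c i = 0"
        using indep ij by blast
      then show False by (simp add: c_def)
    qed
  qed
  have "V.independent (v ` {..d})"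
    unfolding V.independent_explicit_finite_subsets
  proof (intro allI impI ballI)
    fix S u x
    assume S: "S \<subseteq> v ` {..d}" "finite S" "(\<Sum>x\<in>S. vscale (u x) x) = 0" "x \<in> S"
    \<comment> \<open>A relation on the subset \<open>S\<close> is pulled back along
      \<open>v\<close> and padded with zeros, so that the indexed hypothesis applies.\<close>
    define c where "c k = (if v k \<in> S then u (v k) else 0)" for k
    have "(\<Sum>k\<le>d. vscale (c k) (v k)) = (\<Sum>x\<in>v ` {..d}. vscale (if x \<in> S then u x else 0) x)"
      by (simp add: sum.reindex[OF inj] c_def)
    also have "\<dots> = (\<Sum>x\<in>S. vscale (u x) x)"
      by (rule sum.mono_neutral_cong_right) (use S in auto)
    finally have "\<forall>k\<le>d. c k = 0"
      using indep S by metis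
    moreover obtain k where "k \<le> d" "x = v k"
      using S by auto
    ultimately show "u x = 0"
      using \<open>x \<in> S\<close> by (auto simp: c_def)
  qed
  then show ?thesis
    using inj span by (auto simp: is_basis_sequence_def is_basis_of_def atLeast0AtMost)
qed

section \<open>Polynomials evaluated at an algebra element\<close>

lemma alg_poly_altdef:
  assumes "degree p \<le> n"
  shows "alg_poly scale p X = (\<Sum>i\<le>n. scale (coeff p i) (X ^ i))"
  unfolding alg_poly_def
  by (rule sum.mono_neutral_left) (use assms in \<open>auto simp: coeff_eq_0\<close>)

lemma alg_poly_add: "alg_poly scale (p + q) X = alg_poly scale p X + alg_poly scale q X"
  by (simp add: alg_poly_altdef[of _ "max (degree p) (degree q)"] degree_add_le_max
      scale_left_distrib sum.distrib)

lemma alg_poly_smult: "alg_poly scale (smult c p) X = scale c (alg_poly scale p X)"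
  by (simp add: alg_poly_altdef[of _ "degree p"] degree_smult_le scale_sum_right)

lemma alg_poly_diff: "alg_poly scale (p - q) X = alg_poly scale p X - alg_poly scale q X"
  using alg_poly_add[of "p - q" q X] by simp

lemma alg_poly_pCons: "alg_poly scale (pCons a p) X = scale a 1 + X * alg_poly scale p X"
  by (simp add: alg_poly_altdef[of "pCons a p" "Suc (degree p)"] alg_poly_def sum.atMost_Suc_shift
      degree_pCons_le sum_distrib_left scale_mult_right del: sum.atMost_Suc)

lemma alg_poly_linear_factor:
  "alg_poly scale ([:- c, 1:] * p) X = (X - scale c 1) * alg_poly scale p X"
  by (simp add: alg_poly_diff alg_poly_smult alg_poly_pCons left_diff_distrib scale_mult_left)

lemma alg_poly_eigenvector:
  assumes "act X u = vscale c u"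
  shows "act (alg_poly scale p X) u = vscale (poly p c) u"
proof (induction p)
  case 0
  then show ?case by (simp add: alg_poly_def)
next
  case (pCons a p)
  then show ?case
    by (simp add: alg_poly_pCons act_add_left act_scale act_one act_mult act_vscale assms
        V.scale_left_distrib mult.commute)
qed

text \<open>Let \<open>L\<close> vanish at every eigenvalue in the list except \<theta> j. Applying
  \<open>L\<close> evaluated at \<open>X\<close> to the relation kills every term but the j-th,
  which keeps a nonzero factor.\<close>

lemma eigenvectors_independent:
  fixes d :: nat
  assumes "inj_on \<theta> {..d}" and u: "\<And>i. i \<le> d \<Longrightarrow> u i \<noteq> 0"
    and eig: "\<And>i. i \<le> d \<Longrightarrow> act X (u i) = vscale (\<theta> i) (u i)"
    and sum0: "(\<Sum>i\<le>d. vscale (c i) (u i)) = 0" and "j \<le> d"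
  shows "c j = 0"
proof -
  define L where "L = (\<Prod>i\<in>{..d} - {j}. [:- \<theta> i, 1:])"
  have L: "poly L (\<theta> i) = 0 \<longleftrightarrow> i \<noteq> j" if "i \<le> d" for i
    using that assms(1) \<open>j \<le> d\<close> by (auto simp: L_def poly_prod inj_on_def)
  have "0 = act (alg_poly scale L X) (\<Sum>i\<le>d. vscale (c i) (u i))"
    by (simp add: sum0)
  also have "\<dots> = (\<Sum>i\<le>d. if i = j then vscale (c j) (vscale (poly L (\<theta> j)) (u j)) else 0)"
    unfolding act_sum_right
    by (rule sum.cong) (use L in \<open>auto simp: act_vscale alg_poly_eigenvector[OF eig]\<close>)
  finally show ?thesis
    using L[OF \<open>j \<le> d\<close>] u[OF \<open>j \<le> d\<close>] \<open>j \<le> d\<close> by simp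
qed

end

section \<open>Dimension counts relative to a finite spanning set\<close>

lemma (in vector_space) span_eq_UNIV_of_card:
  assumes "independent B" "card B = n" "finite T" "card T \<le> n" "span T = UNIV"
    and "finite B"
  shows "span B = UNIV"
proof (rule ccontr)
  assume "span B \<noteq> UNIV"
  then obtain x where x: "x \<notin> span B" by blast
  then have "independent (insert x B)"
    using assms(1) by (simp add: independent_insert)
  then have "card (insert x B) \<le> card T"
    using independent_span_bound[OF assms(3)] assms(5) by auto
  moreover have "x \<notin> B" using x span_base by blast
  ultimately show False using assms by simp
qed

text \<open>If the n + 1 vectors are distinct they outnumber a spanning set; if two coincide, the
  coefficients 1 and -1 give the relation. The indexed form suits powers of an element, which may
  repeat.\<close>

lemma (in vector_space) dependent_family:
  assumes "finite T" "span T = UNIV" "card T \<le> n"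
  obtains c where "(\<Sum>i\<le>n. scale (c i) (f i)) = 0" "\<exists>i\<le>n. c i \<noteq> 0"
proof (cases "inj_on f {..n}")
  case True
  have "dependent (f ` {..n})"
    using independent_span_bound[OF assms(1), of "f ` {..n}"] assms(2,3) card_image[OF True]
    by auto
  then obtain u where u: "\<exists>v\<in>f ` {..n}. u v \<noteq> 0" "(\<Sum>v\<in>f ` {..n}. scale (u v) v) = 0"
    by (auto simp: dependent_finite)
  show ?thesis
    by (rule that[of "u \<circ> f"]) (use u in \<open>auto simp: sum.reindex[OF True]\<close>)
next
  case False
  then obtain i j where ij: "i \<le> n" "j \<le> n" "i \<noteq> j" "f i = f j"
    by (auto simp: inj_on_def)
  define c :: "nat \<Rightarrow> 'a" where "c k = (if k = i then 1 else if k = j then - 1 else 0)" for k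
  have "(\<Sum>k\<le>n. scale (c k) (f k)) = (\<Sum>k\<in>{i, j}. scale (c k) (f k))"
    by (rule sum.mono_neutral_right) (use ij in \<open>auto simp: c_def\<close>)
  also have "\<dots> = 0"
    using ij by (simp add: c_def)
  finally show ?thesis
    using ij by (intro that[of c]) (auto simp: c_def)
qed

section \<open>Irreducible modules over full matrix algebras\<close>

text \<open>The elementary matrices are pulled back through \<phi>. The product rule and the
  decomposition of 1 are the only facts about matrices that later arguments draw on.\<close>

lemma matrix_algebra_units:
  fixes scale :: "'k::field \<Rightarrow> 'a::ring_1 \<Rightarrow> 'a"
  assumes "matrix_algebra_iso n scale \<phi>"
  obtains e where "\<And>x i j k l. i < n \<Longrightarrow> j < n \<Longrightarrow> k < n \<Longrightarrow> l < n \<Longrightarrow>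
      e i j * x * e k l = scale (\<phi> x $$ (j, k)) (e i l)"
    and "(\<Sum>i<n. e i i) = 1"
proof -
  have bij: "bij_betw \<phi> UNIV (carrier_mat n n)"
    and add: "\<And>x y. \<phi> (x + y) = \<phi> x + \<phi> y"
    and mult: "\<And>x y. \<phi> (x * y) = \<phi> x * \<phi> y"
    and one: "\<phi> 1 = 1\<^sub>m n"
    and smult: "\<And>c x. \<phi> (scale c x) = c \<cdot>\<^sub>m \<phi> x"
    using assms by (auto simp: matrix_algebra_iso_def)
  have inj: "\<phi> x = \<phi> y \<Longrightarrow> x = y" for x y
    using bij by (auto simp: bij_betw_def inj_on_def)
  have car: "\<phi> x \<in> carrier_mat n n" for x
    using bij by (auto simp: bij_betw_def)
  have dims: "dim_row (\<phi> x) = n" "dim_col (\<phi> x) = n" for x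
    using car[of x] by auto
  define M :: "nat \<Rightarrow> nat \<Rightarrow> 'k mat"
    where "M i j = mat n n (\<lambda>(a, b). if a = i \<and> b = j then 1 else 0)" for i j
  define e where "e i j = inv_into UNIV \<phi> (M i j)" for i j
  have M: "M i j \<in> carrier_mat n n" for i j
    by (simp add: M_def)
  have e: "\<phi> (e i j) = M i j" for i j
    using bij_betw_inv_into_right[OF bij M] by (simp add: e_def)
  have prod: "M i j * X * M k l = X $$ (j, k) \<cdot>\<^sub>m M i l"
    if "i < n" "j < n" "k < n" "l < n" "X \<in> carrier_mat n n" for i j k l X
  proof (rule eq_matI)
    fix a b
    assume "a < dim_row (X $$ (j, k) \<cdot>\<^sub>m M i l)" "b < dim_col (X $$ (j, k) \<cdot>\<^sub>m M i l)"
    then have ab: "a < n" "b < n" by (auto simp: M_def)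
    \<comment> \<open>Multiplying by \<open>M i j\<close> on the left moves row j to row i and
      clears all other rows; \<open>M k l\<close> on the right does the same with columns.\<close>
    have MX: "(M i j * X) $$ (a, t) = (if a = i then X $$ (j, t) else 0)" if "t < n" for t
    proof -
      have "(M i j * X) $$ (a, t) = (\<Sum>s<n. if s = j then (if a = i then X $$ (s, t) else 0) else 0)"
      proof -
        have "(M i j * X) $$ (a, t) = (\<Sum>s<n. M i j $$ (a, s) * X $$ (s, t))"
          using that ab \<open>X \<in> _\<close> M[of i j]
          by (auto simp: scalar_prod_def atLeast0LessThan intro!: sum.cong)
        also have "\<dots> = (\<Sum>s<n. if s = j then (if a = i then X $$ (s, t) else 0) else 0)"
          by (rule sum.cong) (use ab in \<open>auto simp: M_def\<close>)
        finally show ?thesis .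
      qed
      then show ?thesis using \<open>j < n\<close> by simp
    qed
    have "(M i j * X * M k l) $$ (a, b) = (\<Sum>t<n. (M i j * X) $$ (a, t) * M k l $$ (t, b))"
      using ab \<open>X \<in> _\<close> M[of i j] M[of k l]
      by (auto simp: scalar_prod_def atLeast0LessThan simp del: assoc_mult_mat intro!: sum.cong)
    also have "\<dots> = (\<Sum>t<n. if t = k then (if a = i \<and> b = l then X $$ (j, t) else 0) else 0)"
      using ab by (intro sum.cong) (auto simp: MX, auto simp: M_def)
    also have "\<dots> = (X $$ (j, k) \<cdot>\<^sub>m M i l) $$ (a, b)"
      using ab \<open>k < n\<close> by (simp add: M_def)
    finally show "(M i j * X * M k l) $$ (a, b) = (X $$ (j, k) \<cdot>\<^sub>m M i l) $$ (a, b)" .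
  qed (use \<open>X \<in> _\<close> in \<open>simp_all add: M_def\<close>)
  have zero: "\<phi> 0 $$ (a, b) = 0" if "a < n" "b < n" for a b
  proof -
    have "\<phi> (0 + 0) $$ (a, b) = \<phi> 0 $$ (a, b) + \<phi> 0 $$ (a, b)"
      unfolding add using that by (simp add: dims)
    then show ?thesis by (metis add.right_neutral add_left_cancel)
  qed
  \<comment> \<open>Matrices of all sizes share one type, so the image of a sum is computed entry by
    entry.\<close>
  have sum: "\<phi> (\<Sum>i\<in>I. f i) $$ (a, b) = (\<Sum>i\<in>I. \<phi> (f i) $$ (a, b))"
    if "a < n" "b < n" "finite I" for a b and f :: "nat \<Rightarrow> 'a" and I
    using that(3) by induction (use that in \<open>simp_all add: zero add dims\<close>)
  have "\<phi> (\<Sum>i<n. e i i) = \<phi> 1"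
  proof (rule eq_matI)
    fix a b assume "a < dim_row (\<phi> 1)" "b < dim_col (\<phi> 1)"
    then have ab: "a < n" "b < n" by (simp_all add: dims)
    have "\<phi> (\<Sum>i<n. e i i) $$ (a, b) = (\<Sum>i<n. if i = a then (if a = b then 1 else 0) else 0)"
      unfolding sum[OF ab finite_lessThan]
      by (rule sum.cong) (use ab in \<open>auto simp: e M_def\<close>)
    then show "\<phi> (\<Sum>i<n. e i i) $$ (a, b) = \<phi> 1 $$ (a, b)"
      using ab by (simp add: one)
  qed (simp_all add: dims)
  then have "(\<Sum>i<n. e i i) = 1" by (rule inj)
  moreover have "e i j * x * e k l = scale (\<phi> x $$ (j, k)) (e i l)"
    if "i < n" "j < n" "k < n" "l < n" for x i j k l
    by (rule inj) (simp add: mult smult e prod that car)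
  ultimately show ?thesis using that by blast
qed

locale irreducible_matrix_module = algebra_module scale act
  for scale :: "'k::field \<Rightarrow> 'a::ring_1 \<Rightarrow> 'a"
    and act :: "'a \<Rightarrow> 'v::ab_group_add \<Rightarrow> 'v" +
  fixes d :: nat
  assumes full: "full_matrix_algebra d scale"
    and irreducible: "irreducible_left_module act"
begin

text \<open>The coefficients \<open>c x i j\<close> are the matrix entries of \<open>x\<close>. The
  expansion comes from multiplying \<open>x\<close> on both sides by 1, written as the sum of the
  \<open>e i i\<close>.\<close>

lemma matrix_units:
  obtains e :: "nat \<Rightarrow> nat \<Rightarrow> 'a" and c :: "'a \<Rightarrow> nat \<Rightarrow> nat \<Rightarrow> 'k"
  where "\<And>x i j k l. i \<le> d \<Longrightarrow> j \<le> d \<Longrightarrow> k \<le> d \<Longrightarrow> l \<le> d \<Longrightarrow>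
      e i j * x * e k l = scale (c x j k) (e i l)"
    and "(\<Sum>i\<le>d. e i i) = 1"
    and "\<And>x. x = (\<Sum>i\<le>d. \<Sum>j\<le>d. scale (c x i j) (e i j))"
proof -
  obtain \<phi> where "matrix_algebra_iso (d + 1) scale \<phi>"
    using full by (auto simp: full_matrix_algebra_def)
  then obtain e where e: "\<And>x i j k l. i < d + 1 \<Longrightarrow> j < d + 1 \<Longrightarrow> k < d + 1 \<Longrightarrow> l < d + 1 \<Longrightarrow>
      e i j * x * e k l = scale (\<phi> x $$ (j, k)) (e i l)"
    and one: "(\<Sum>i<d + 1. e i i) = 1"
    using matrix_algebra_units by blast
  have one': "(\<Sum>i\<le>d. e i i) = 1"
    using one by (simp add: lessThan_Suc_atMost)
  have "x = (\<Sum>i\<le>d. e i i) * x * (\<Sum>j\<le>d. e j j)" for x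
    by (simp add: one')
  also have "\<dots>x = (\<Sum>i\<le>d. \<Sum>j\<le>d. scale (\<phi> x $$ (i, j)) (e i j))" for x
    unfolding sum_distrib_left sum_distrib_right
    by (subst sum.swap) (intro sum.cong; simp add: e)
  finally show ?thesis
    using e one' by (intro that[of e "\<lambda>x i j. \<phi> x $$ (i, j)"]) auto
qed

text \<open>This is the simplicity of the matrix algebra: if the (i,j) entry of \<open>x\<close> is
  nonzero, then \<open>e k i * x * e j k\<close> is a nonzero multiple of \<open>e k k\<close>. If
  \<open>x\<close> acted as zero, so would every \<open>e k k\<close> and hence 1, although the
  module is nonzero.\<close>

lemma faithful:
  assumes "\<And>v. act x v = 0"
  shows "x = 0"
proof (rule ccontr)
  assume "x \<noteq> 0"
  obtain e c where e: "\<And>x i j k l. i \<le> d \<Longrightarrow> j \<le> d \<Longrightarrow> k \<le> d \<Longrightarrow> l \<le> d \<Longrightarrow>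
      e i j * x * e k l = scale (c x j k) (e i l)"
    and one: "(\<Sum>i\<le>d. e i i) = 1"
    and expand: "\<And>x. x = (\<Sum>i\<le>d. \<Sum>j\<le>d. scale (c x i j) (e i j))"
    using matrix_units by blast
  obtain i j where ij: "i \<le> d" "j \<le> d" "c x i j \<noteq> 0"
  proof (rule ccontr)
    assume "\<not> thesis"
    then have "c x i j = 0" if "i \<le> d" "j \<le> d" for i j
      using that \<open>\<And>i j. i \<le> d \<Longrightarrow> j \<le> d \<Longrightarrow> c x i j \<noteq> 0 \<Longrightarrow> thesis\<close> by blast
    then have "(\<Sum>i\<le>d. \<Sum>j\<le>d. scale (c x i j) (e i j)) = 0" by simp
    then show False using expand[of x] \<open>x \<noteq> 0\<close> by simp
  qed
  have "act (e k k) v = 0" if "k \<le> d" for k v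
  proof -
    have "vscale (c x i j) (act (e k k) v) = act (e k i * x * e j k) v"
      using e[of k i j k x] ij that by (simp add: act_scale)
    also have "\<dots> = 0" by (simp add: act_mult assms)
    finally show ?thesis using ij by simp
  qed
  then have "act 1 v = 0" for v
    by (simp add: act_sum_left flip: one)
  then show False
    using irreducible by (auto simp: irreducible_left_module_def act_one)
qed

lemma faithful_eq: "(\<And>v. act x v = act y v) \<Longrightarrow> x = y"
  using faithful[of "x - y"] by (simp add: act_diff_left)

text \<open>Some \<open>w = act (e k k) v\<close> is nonzero and generates the module by
  irreducibility. Since \<open>y * e k k\<close> is a combination of the k-th column of matrix
  units, the vectors \<open>act (e i k) v\<close> span.\<close>

lemma spanning_set:
  obtains T where "finite T" "card T \<le> d + 1" "V.span T = UNIV"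
proof -
  obtain e c where e: "\<And>x i j k l. i \<le> d \<Longrightarrow> j \<le> d \<Longrightarrow> k \<le> d \<Longrightarrow> l \<le> d \<Longrightarrow>
      e i j * x * e k l = scale (c x j k) (e i l)"
    and one: "(\<Sum>i\<le>d. e i i) = 1"
    and "\<And>x. x = (\<Sum>i\<le>d. \<Sum>j\<le>d. scale (c x i j) (e i j))"
    by (rule matrix_units) blast
  obtain v :: 'v where "v \<noteq> 0"
    using irreducible by (auto simp: irreducible_left_module_def)
  then have "(\<Sum>k\<le>d. act (e k k) v) \<noteq> 0"
    by (simp add: one act_one flip: act_sum_left)
  then obtain k where k: "k \<le> d" "act (e k k) v \<noteq> 0"
    by (metis (no_types, lifting) atMost_iff sum.not_neutral_contains_not_neutral)
  define w where "w = act (e k k) v"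
  have "submodule act (range (\<lambda>x. act x w))"
    unfolding submodule_def
    by (auto simp flip: act_add_left act_mult) (metis act_zero_left rangeI)
  moreover have "w \<in> range (\<lambda>x. act x w)"
    by (metis act_one rangeI)
  ultimately have gen: "range (\<lambda>x. act x w) = UNIV"
    using irreducible k by (auto simp: irreducible_left_module_def w_def)
  have "x \<in> V.span ((\<lambda>i. act (e i k) v) ` {..d})" for x
  proof -
    obtain y where "x = act y w" using gen by blast
    also have "\<dots> = act ((\<Sum>i\<le>d. e i i) * y * e k k) v"
      by (simp add: one w_def act_mult)
    also have "\<dots> = (\<Sum>i\<le>d. vscale (c y i k) (act (e i k) v))"
      unfolding sum_distrib_right act_sum_left
      by (rule sum.cong) (use k in \<open>auto simp: e act_scale\<close>)
    finally show ?thesis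
      by (simp only:) (intro V.span_sum V.span_scale V.span_base; simp)
  qed
  moreover have "card ((\<lambda>i. act (e i k) v) ` {..d}) \<le> d + 1"
    using card_image_le[of "{..d}" "\<lambda>i. act (e i k) v"] by simp
  ultimately show ?thesis
    by (intro that[of "(\<lambda>i. act (e i k) v) ` {..d}"]) auto
qed

section \<open>Minimal polynomials and eigenvectors\<close>

lemma annihilating_polynomial: "\<exists>p. lead_coeff p = 1 \<and> alg_poly scale p X = 0"
proof -
  obtain e c where "\<And>x i j k l. i \<le> d \<Longrightarrow> j \<le> d \<Longrightarrow> k \<le> d \<Longrightarrow> l \<le> d \<Longrightarrow>
      e i j * x * e k l = scale (c x j k) (e i l)"
    and "(\<Sum>i\<le>d. e i i) = 1"
    and expand: "\<And>x. x = (\<Sum>i\<le>d. \<Sum>j\<le>d. scale (c x i j) (e i j))"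
    by (rule matrix_units) blast
  \<comment> \<open>The matrix units span the algebra, so the \<open>card T + 1\<close> powers of
    \<open>X\<close> from exponent 0 on are linearly dependent; the relation provides the polynomial
    \<open>p\<close>.\<close>
  define T where "T = (\<lambda>(i, j). e i j) ` ({..d} \<times> {..d})"
  have "x \<in> span T" for x
    by (subst expand[of x], intro span_sum span_scale span_base) (auto simp: T_def)
  then have "span T = UNIV" "finite T"
    by (auto simp: T_def)
  then obtain a where a: "(\<Sum>i\<le>card T. scale (a i) (X ^ i)) = 0" "\<exists>i\<le>card T. a i \<noteq> 0"
    using dependent_family[of T "card T" "\<lambda>i. X ^ i"] by blast
  define p where "p = (\<Sum>i\<le>card T. monom (a i) i)"
  have coeff: "coeff p i = (if i \<le> card T then a i else 0)" for i
    by (simp add: p_def coeff_sum)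
  then have "p \<noteq> 0" using a by (metis coeff_0)
  have "degree p \<le> card T"
    by (rule degree_le) (simp add: coeff)
  then have "alg_poly scale p X = 0"
    using a by (simp add: alg_poly_altdef coeff)
  then show ?thesis
    using \<open>p \<noteq> 0\<close> by (intro exI[of _ "smult (1 / lead_coeff p) p"]) (simp add: alg_poly_smult)
qed

text \<open>The \<open>ARG_MIN\<close> is meaningful because a monic annihilator exists. Minimality
  extends to nonzero annihilators that are not monic by dividing by the leading coefficient.\<close>

lemma min_poly_props:
  shows "lead_coeff (min_poly scale X) = 1" "alg_poly scale (min_poly scale X) X = 0"
    and "\<And>p. p \<noteq> 0 \<Longrightarrow> alg_poly scale p X = 0 \<Longrightarrow> degree (min_poly scale X) \<le> degree p"
proof -
  let ?P = "\<lambda>p. lead_coeff p = 1 \<and> alg_poly scale p X = 0"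
  obtain q where q: "?P q" using annihilating_polynomial by blast
  show "lead_coeff (min_poly scale X) = 1" "alg_poly scale (min_poly scale X) X = 0"
    using arg_min_natI[of ?P q degree, OF q] by (auto simp: min_poly_def)
  fix p assume "p \<noteq> 0" "alg_poly scale p X = 0"
  then have "?P (smult (1 / lead_coeff p) p)"
    by (simp add: alg_poly_smult)
  from arg_min_nat_le[of ?P, OF this, of degree] \<open>p \<noteq> 0\<close>
  show "degree (min_poly scale X) \<le> degree p" by (simp add: min_poly_def)
qed

text \<open>Split off the linear factor at \<xi>, leaving \<open>q\<close>. By minimality
  \<open>q\<close> does not annihilate \<open>X\<close>, so by faithfulness its value moves some
  \<open>v\<close> to a nonzero vector, and that vector is the eigenvector.\<close>

lemma eigenvector_exists:
  assumes "\<xi> \<in> eigenvalues scale X"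
  obtains u where "u \<noteq> 0" "act X u = vscale \<xi> u"
proof -
  obtain q where q: "min_poly scale X = [:- \<xi>, 1:] * q"
    using assms by (auto simp: eigenvalues_def poly_eq_0_iff_dvd dvd_def)
  have "q \<noteq> 0" using min_poly_props(1)[of X] q by auto
  have "degree (min_poly scale X) = Suc (degree q)"
    using \<open>q \<noteq> 0\<close> unfolding q by (subst degree_mult_eq) auto
  then have "alg_poly scale q X \<noteq> 0"
    using min_poly_props(3)[of q X] \<open>q \<noteq> 0\<close> by auto
  then obtain v where v: "act (alg_poly scale q X) v \<noteq> 0"
    using faithful by blast
  have "(X - scale \<xi> 1) * alg_poly scale q X = 0"
    using min_poly_props(2)[of X] unfolding q alg_poly_linear_factor .
  then have "act (X - scale \<xi> 1) (act (alg_poly scale q X) v) = 0"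
    by (metis act_mult act_zero_left)
  then show ?thesis
    using v by (intro that) (auto simp: act_diff_left act_scale act_one)
qed

section \<open>Spectral resolutions\<close>

text \<open>The last clause expresses that each image is a line, in terms of a nonzero image vector
  instead of a dimension. No operator occurs, so a family can serve for its components alone,
  without eigenvalues.\<close>

definition rank_one_resolution :: "(nat \<Rightarrow> 'a) \<Rightarrow> bool" where
  "rank_one_resolution E \<longleftrightarrow>
     (\<forall>i\<le>d. \<forall>j\<le>d. E i * E j = (if i = j then E i else 0)) \<and>
     (\<Sum>i\<le>d. E i) = 1 \<and>
     (\<forall>i\<le>d. E i \<noteq> 0) \<and>
     (\<forall>i\<le>d. \<forall>v w. act (E i) v \<noteq> 0 \<longrightarrow> (\<exists>c. act (E i) w = vscale c (act (E i) v)))"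

definition spectral_resolution :: "'a \<Rightarrow> (nat \<Rightarrow> 'a) \<Rightarrow> (nat \<Rightarrow> 'k) \<Rightarrow> bool" where
  "spectral_resolution X E \<theta> \<longleftrightarrow>
     rank_one_resolution E \<and> inj_on \<theta> {..d} \<and> (\<forall>i\<le>d. E i * X = scale (\<theta> i) (E i))"

text \<open>A primitive idempotent is a Lagrange interpolation polynomial in \<open>X\<close>, so
  \<open>E i\<close> fixes the eigenvector \<open>u i\<close> and kills the others. The eigenvectors
  form a basis by counting, and by faithfulness every identity in the algebra can be tested on
  them.\<close>

lemma primitive_idempotents_spectral_resolution:
  assumes mf: "multiplicity_free d scale X"
    and ord: "idempotent_ordering d scale X E"
    and seq: "eigenvalue_sequence d scale X E \<theta>"
  shows "spectral_resolution X E \<theta>"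
proof -
  have \<theta>: "\<theta> i \<in> eigenvalues scale X" "E i = primitive_idempotent scale X (\<theta> i)" if "i \<le> d" for i
    using seq that by (auto simp: eigenvalue_sequence_def)
  \<comment> \<open>Distinct idempotents come from distinct eigenvalues, so the d + 1 values
    \<theta> i exhaust the eigenvalue set and the product defining \<open>E i\<close> can be indexed
    by them.\<close>
  have "inj_on E {..d}"
    using ord by (auto simp: idempotent_ordering_def bij_betw_def atLeast0AtMost)
  then have inj: "inj_on \<theta> {..d}"
    using \<theta>(2) by (auto simp: inj_on_def)
  have card: "card (eigenvalues scale X) = d + 1"
    using mf by (simp add: multiplicity_free_def)
  have eigs: "eigenvalues scale X = \<theta> ` {..d}"
    by (rule sym, rule card_subset_eq)
      (use \<theta> card card_image[OF inj] in \<open>auto intro: card_ge_0_finite\<close>)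
  have "\<forall>i. \<exists>u. i \<le> d \<longrightarrow> u \<noteq> 0 \<and> act X u = vscale (\<theta> i) u"
    using eigenvector_exists \<theta>(1) by metis
  then obtain u where u: "\<And>i. i \<le> d \<Longrightarrow> u i \<noteq> 0"
    and eig: "\<And>i. i \<le> d \<Longrightarrow> act X (u i) = vscale (\<theta> i) (u i)"
    by metis
  have Eu: "act (E i) (u j) = (if i = j then u j else 0)" if "i \<le> d" "j \<le> d" for i j
  proof -
    let ?L = "\<Prod>\<zeta>\<in>\<theta> ` {..d} - {\<theta> i}. smult (1 / (\<theta> i - \<zeta>)) [:- \<zeta>, 1:]"
    have "poly ?L (\<theta> j) = (\<Prod>\<zeta>\<in>\<theta> ` {..d} - {\<theta> i}. (\<theta> j - \<zeta>) / (\<theta> i - \<zeta>))"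
      by (simp add: poly_prod diff_divide_distrib)
    also have "\<dots> = (if i = j then 1 else 0)"
    proof (cases "i = j")
      case True
      then show ?thesis by (auto intro!: prod.neutral)
    next
      case False
      then have "\<theta> j \<in> \<theta> ` {..d} - {\<theta> i}"
        using inj that by (auto simp: inj_on_def)
      then show ?thesis
        using False by (auto intro!: prod_zero bexI[of _ "\<theta> j"])
    qed
    finally show ?thesis
      using that by (simp add: \<theta>(2) primitive_idempotent_def eigs alg_poly_eigenvector[OF eig])
  qed
  have indep: "\<forall>i\<le>d. c i = 0" if "(\<Sum>i\<le>d. vscale (c i) (u i)) = 0" for c
    using eigenvectors_independent[OF inj u eig that] by blast
  have uinj: "inj_on u {..d}"
  proof (rule inj_onI)
    fix i j assume ij: "i \<in> {..d}" "j \<in> {..d}" "u i = u j"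
    then show "i = j"
      using Eu[of i i] Eu[of i j] u[of i] by (auto split: if_splits)
  qed
  have ind: "V.independent (u ` {..d})"
    unfolding V.dependent_finite[OF finite_imageI[OF finite_atMost]] sum.reindex[OF uinj]
    using indep[of "\<lambda>i. f (u i)" for f] by (auto simp: o_def)
  obtain T where T: "finite T" "card T \<le> d + 1" "V.span T = UNIV"
    using spanning_set by blast
  have "V.span (u ` {..d}) = UNIV"
    by (rule V.span_eq_UNIV_of_card[OF ind _ T]) (simp_all add: card_image[OF uinj])
  then have expand: "\<exists>c. x = (\<Sum>i\<le>d. vscale (c i) (u i))" for x
  proof -
    have "x \<in> range (\<lambda>c. \<Sum>v\<in>u ` {..d}. vscale (c v) v)"
      using \<open>V.span (u ` {..d}) = UNIV\<close> V.span_finite[of "u ` {..d}"] by auto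
    then obtain c where "x = (\<Sum>v\<in>u ` {..d}. vscale (c v) v)" by blast
    then show ?thesis
      by (intro exI[of _ "c \<circ> u"]) (simp add: sum.reindex[OF uinj])
  qed
  have ext: "x = y" if xy: "\<And>j. j \<le> d \<Longrightarrow> act x (u j) = act y (u j)" for x y
  proof (rule faithful_eq)
    fix v
    obtain c where "v = (\<Sum>i\<le>d. vscale (c i) (u i))" using expand by blast
    then show "act x v = act y v"
      using xy by (simp add: act_sum_right act_vscale)
  qed
  have "E i * E j = (if i = j then E i else 0)" if "i \<le> d" "j \<le> d" for i j
    by (rule ext) (use that in \<open>auto simp: act_mult Eu\<close>)
  moreover have "(\<Sum>i\<le>d. E i) = 1"
  proof (rule ext)
    fix j assume "j \<le> d"
    then have "act (\<Sum>i\<le>d. E i) (u j) = (\<Sum>i\<le>d. if i = j then u j else 0)"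
      unfolding act_sum_left by (intro sum.cong) (simp_all add: Eu)
    then show "act (\<Sum>i\<le>d. E i) (u j) = act 1 (u j)"
      using \<open>j \<le> d\<close> by (simp add: act_one)
  qed
  moreover have "E i \<noteq> 0" if "i \<le> d" for i
    using Eu[OF that that] u[OF that] by auto
  moreover have "\<exists>c. act (E i) w = vscale c (act (E i) v)" if "i \<le> d" "act (E i) v \<noteq> 0" for i v w
  proof -
    have line: "\<exists>c. act (E i) x = vscale c (u i)" for x
    proof -
      obtain c where "x = (\<Sum>j\<le>d. vscale (c j) (u j))" using expand by blast
      then have "act (E i) x = (\<Sum>j\<le>d. vscale (c j) (act (E i) (u j)))"
        by (simp add: act_sum_right act_vscale)
      also have "\<dots> = (\<Sum>j\<le>d. if j = i then vscale (c i) (u i) else 0)"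
        by (rule sum.cong) (use \<open>i \<le> d\<close> in \<open>auto simp: Eu\<close>)
      finally show ?thesis using \<open>i \<le> d\<close> by auto
    qed
    obtain a b where ab: "act (E i) v = vscale a (u i)" "act (E i) w = vscale b (u i)"
      using line by blast
    \<comment> \<open>The scalar \<open>a\<close> is nonzero because \<open>act (E i) v\<close>
      is.\<close>
    then have "act (E i) w = vscale (b / a) (act (E i) v)"
      using that by auto
    then show ?thesis by blast
  qed
  moreover have "E i * X = scale (\<theta> i) (E i)" if "i \<le> d" for i
    by (rule ext) (use that in \<open>auto simp: act_mult eig act_vscale act_scale Eu\<close>)
  ultimately show ?thesis
    using inj by (simp add: spectral_resolution_def rank_one_resolution_def)
qed

lemma resolution_sum:
  assumes "rank_one_resolution E"
  shows "(\<Sum>i\<le>d. act (E i) x) = x"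
  using assms by (simp add: rank_one_resolution_def act_one flip: act_sum_left)

text \<open>Orthogonality gives one direction, and splitting \<open>x\<close> into its components
  gives the other. Membership in an intersection of flags thereby becomes two lists of vanishing
  components.\<close>

lemma mem_idempotent_sum:
  assumes E: "rank_one_resolution E" and "n \<le> d"
  shows "x \<in> idempotent_sum act E m n \<longleftrightarrow> (\<forall>k\<le>d. k \<notin> {m..n} \<longrightarrow> act (E k) x = 0)"
proof
  assume "x \<in> idempotent_sum act E m n"
  then obtain s where x: "x = (\<Sum>j\<in>{m..n}. s j)" and "\<forall>j\<in>{m..n}. s j \<in> range (act (E j))"
    by (auto simp: idempotent_sum_def set_sum_alt)
  then obtain y where y: "\<forall>j\<in>{m..n}. s j = act (E j) (y j)"
    by (simp add: image_iff) metis
  show "\<forall>k\<le>d. k \<notin> {m..n} \<longrightarrow> act (E k) x = 0"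
  proof (intro allI impI)
    fix k assume k: "k \<le> d" "k \<notin> {m..n}"
    have "act (E k) (s j) = 0" if "j \<in> {m..n}" for j
    proof -
      have "act (E k) (s j) = act (E k * E j) (y j)"
        using y that by (simp add: act_mult)
      also have "E k * E j = 0"
        using E k that \<open>n \<le> d\<close> by (auto simp: rank_one_resolution_def)
      finally show ?thesis by simp
    qed
    then show "act (E k) x = 0"
      by (simp add: x act_sum_right)
  qed
next
  assume "\<forall>k\<le>d. k \<notin> {m..n} \<longrightarrow> act (E k) x = 0"
  then have "(\<Sum>j\<in>{m..n}. act (E j) x) = (\<Sum>j\<le>d. act (E j) x)"
    using \<open>n \<le> d\<close> by (intro sum.mono_neutral_left) auto
  then have "x = (\<Sum>j\<in>{m..n}. act (E j) x)"
    by (simp add: resolution_sum[OF E])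
  then show "x \<in> idempotent_sum act E m n"
    unfolding idempotent_sum_def set_sum_alt[OF finite_atLeastAtMost] by blast
qed

lemma rank_one_span:
  assumes "rank_one_resolution E" "i \<le> d" "act (E i) v \<noteq> 0"
  shows "\<exists>c. act (E i) w = vscale c (act (E i) v)"
  using assms by (simp add: rank_one_resolution_def)

section \<open>Products of shifted copies of an operator\<close>

lemma ascending_product_0 [simp]: "ascending_product scale X t 0 = 1"
  by (simp add: ascending_product_def)

lemma ascending_product_Suc:
  "ascending_product scale X t (Suc m) = ascending_product scale X t m * (X - scale (t m) 1)"
  by (simp add: ascending_product_def)

text \<open>The product grows on the right, next to the vector. Commuting \<open>X\<close> past it
  lets the next vector be computed from the previous one.\<close>

lemma ascending_product_commute:
  "ascending_product scale X t m * X = X * ascending_product scale X t m"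
proof (induction m)
  case (Suc m)
  have "(X - scale c 1) * X = X * (X - scale c 1)" for c
    by (simp add: algebra_simps scale_mult_left scale_mult_right)
  with Suc show ?case
    by (metis ascending_product_Suc mult.assoc)
qed simp

lemma act_ascending_product_Suc:
  "act (ascending_product scale X t (Suc m)) y =
     act X (act (ascending_product scale X t m) y) - vscale (t m) (act (ascending_product scale X t m) y)"
  by (simp add: ascending_product_Suc right_diff_distrib ascending_product_commute scale_mult_right
      act_diff_left act_mult act_scale)

text \<open>For j < m the factor with h = j makes the scalar zero. This places the vectors built
  from the products in the flag of the last idempotents.\<close>

lemma idempotent_ascending_product:
  assumes "spectral_resolution X E \<theta>" "j \<le> d"
  shows "E j * ascending_product scale X \<theta> m = scale (\<Prod>h<m. \<theta> j - \<theta> h) (E j)"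
proof (induction m)
  case (Suc m)
  have "E j * (X - scale (\<theta> m) 1) = scale (\<theta> j - \<theta> m) (E j)"
    using assms by (simp add: spectral_resolution_def right_diff_distrib scale_mult_right
        scale_left_diff_distrib)
  with Suc show ?case
    by (simp add: ascending_product_Suc scale_mult_left mult.assoc[symmetric] mult.commute)
qed simp

section \<open>The bases attached to a pair of resolutions\<close>

definition attached_basis :: "(nat \<Rightarrow> 'v) \<Rightarrow> (nat \<Rightarrow> 'v set) \<Rightarrow> bool" where
  "attached_basis v W \<longleftrightarrow>
     (\<forall>i\<le>d. is_basis_of vscale {v i} (W i)) \<and> is_basis_sequence vscale d v"

lemma singleton_is_basis_of:
  assumes "x \<noteq> 0" "\<And>c. vscale c x \<in> W" "\<And>z. z \<in> W \<Longrightarrow> \<exists>c. z = vscale c x"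
  shows "is_basis_of vscale {x} W"
  using assms by (auto simp: is_basis_of_def V.span_singleton image_iff)

text \<open>Only indices up to \<open>d\<close> count. This matters because subtraction truncates,
  so \<open>d - (d - i) = i\<close> fails beyond \<open>d\<close>.\<close>

lemma attached_basis_cong:
  assumes "attached_basis v W" "\<And>i. i \<le> d \<Longrightarrow> v i = v' i" "\<And>i. i \<le> d \<Longrightarrow> W i = W' i"
  shows "attached_basis v' W'"
proof -
  have "v ` {0..d} = v' ` {0..d}"
    by (rule image_cong) (simp_all add: assms(2))
  moreover have "inj_on v {0..d} = inj_on v' {0..d}"
    by (rule inj_on_cong) (simp add: assms(2))
  ultimately show ?thesis
    using assms by (simp add: attached_basis_def is_basis_sequence_def)
qed

text \<open>Interchanging the last two symbols of an ordering reverses its basis, so half of the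
  table follows from the other half.\<close>

lemma attached_basis_reverse:
  assumes "attached_basis v W"
  shows "attached_basis (\<lambda>i. v (d - i)) (\<lambda>i. W (d - i))"
proof -
  have rev: "bij_betw (\<lambda>i. d - i) {0..d} {0..d}"
    by (rule bij_betwI[of _ _ _ "\<lambda>i. d - i"]) auto
  have "(\<lambda>i. v (d - i)) ` {0..d} = v ` {0..d}"
    using bij_betw_imp_surj_on[OF rev] by (metis image_image)
  moreover have "inj_on (\<lambda>i. v (d - i)) {0..d}"
    using comp_inj_on[of "\<lambda>i. d - i" "{0..d}" v] rev assms
    by (simp add: bij_betw_def attached_basis_def is_basis_sequence_def o_def)
  ultimately show ?thesis
    using assms by (simp add: attached_basis_def is_basis_sequence_def)
qed

section \<open>The vectors obtained from one end vector\<close>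

context
  fixes A :: 'a and E Es :: "nat \<Rightarrow> 'a" and \<theta> :: "nat \<Rightarrow> 'k" and y :: 'v and v :: "nat \<Rightarrow> 'v"
  assumes spec: "spectral_resolution A E \<theta>"
    and res: "rank_one_resolution Es"
    and tri: "tridiagonal_products d A Es"
    and y: "y \<noteq> 0" "y \<in> range (act (Es 0))"
  defines "v \<equiv> \<lambda>i. act (ascending_product scale A \<theta> i) y"
begin

lemma res_E: "rank_one_resolution E"
  using spec by (simp add: spectral_resolution_def)

text \<open>\<open>A\<close> raises the highest index of a nonzero \<open>Es\<close> component by at
  most one, and the new top component is nonzero because the subdiagonal product is nonzero on the
  line \<open>range (act (Es i))\<close>.\<close>

lemma split_vector_leading:
  assumes "i \<le> d"
  shows "(\<forall>j\<le>d. i < j \<longrightarrow> act (Es j) (v i) = 0) \<and> act (Es i) (v i) \<noteq> 0"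
  using assms
proof (induction i)
  case 0
  obtain z where z: "y = act (Es 0) z" using y by blast
  have "act (Es j) y = (if j = 0 then y else 0)" if "j \<le> d" for j
  proof -
    have "act (Es j) y = act (Es j * Es 0) z"
      by (simp add: z act_mult)
    also have "Es j * Es 0 = (if j = 0 then Es 0 else 0)"
      using res that by (simp add: rank_one_resolution_def)
    finally show ?thesis by (simp add: z)
  qed
  then show ?case using y by (simp add: v_def act_one)
next
  case (Suc i)
  let ?x = "v i"
  have low: "act (Es j) ?x = 0" if "j \<le> d" "i < j" for j
    using Suc that by auto
  have top: "act (Es i) ?x \<noteq> 0" using Suc by auto
  \<comment> \<open>Above index i the shift by \<theta> i contributes nothing. After inserting the
    sum of the \<open>Es k\<close>, terms with k < i vanish by tridiagonality and terms with k > i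
    by the induction hypothesis.\<close>
  have step: "act (Es j) (v (Suc i)) = act (Es j * A * Es i) ?x" if "j \<le> d" "Suc i \<le> j" for j
  proof -
    have "act (Es j) (v (Suc i)) = act (Es j) (act A ?x)"
      using low[of j] that by (simp add: v_def act_ascending_product_Suc act_diff_right act_vscale)
    also have "\<dots> = act (Es j) (act A (\<Sum>k\<le>d. act (Es k) ?x))"
      by (simp add: resolution_sum[OF res])
    also have "\<dots> = (\<Sum>k\<le>d. act (Es j * A * Es k) ?x)"
      by (simp add: act_sum_right act_mult)
    also have "\<dots> = (\<Sum>k\<in>{i}. act (Es j * A * Es k) ?x)"
    proof (rule sum.mono_neutral_right)
      show "\<forall>k\<in>{..d} - {i}. act (Es j * A * Es k) ?x = 0"
      proof
        fix k assume k: "k \<in> {..d} - {i}"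
        show "act (Es j * A * Es k) ?x = 0"
        proof (cases "k < i")
          case True
          then have "Es j * A * Es k = 0"
            using tri that k by (auto simp: tridiagonal_products_def)
          then show ?thesis by simp
        next
          case False
          then show ?thesis using low[of k] k by (simp add: act_mult)
        qed
      qed
    qed (use Suc.prems in auto)
    finally show ?thesis by simp
  qed
  have "act (Es j) (v (Suc i)) = 0" if "j \<le> d" "Suc i < j" for j
  proof -
    have "Es j * A * Es i = 0"
      using tri that by (auto simp: tridiagonal_products_def)
    then show ?thesis using step[of j] that by simp
  qed
  moreover have "act (Es (Suc i)) (v (Suc i)) \<noteq> 0"
  proof
    assume 0: "act (Es (Suc i)) (v (Suc i)) = 0"
    \<comment> \<open>Each \<open>act (Es i) w\<close> is a multiple of
      \<open>act (Es i) ?x\<close>, so vanishing at \<open>?x\<close> spreads to the whole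
      module.\<close>
    have "act (Es (Suc i) * A * Es i) w = 0" for w
    proof -
      obtain c where "act (Es i) w = vscale c (act (Es i) ?x)"
        using rank_one_span[OF res _ top] Suc by auto
      then have "act (Es (Suc i) * A * Es i) w = vscale c (act (Es (Suc i) * A * Es i) ?x)"
        by (simp add: act_mult act_vscale)
      then show ?thesis
        using 0 step[of "Suc i"] Suc by simp
    qed
    then have "Es (Suc i) * A * Es i = 0" by (rule faithful)
    then show False
      using tri Suc by (auto simp: tridiagonal_products_def)
  qed
  ultimately show ?case by blast
qed

text \<open>Elimination from the top: a multiple of \<open>v m\<close> removes component m. With m =
  d + 1 nothing is required of \<open>x\<close>, so the vectors span everything; smaller m controls
  the steps of the flag.\<close>

lemma split_vectors_span:
  assumes "m \<le> d + 1" "\<And>k. k \<le> d \<Longrightarrow> m \<le> k \<Longrightarrow> act (Es k) x = 0"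
  shows "\<exists>c. x = (\<Sum>k<m. vscale (c k) (v k))"
  using assms
proof (induction m arbitrary: x)
  case 0
  then have "x = 0" using resolution_sum[OF res, of x] by simp
  then show ?case by simp
next
  case (Suc m)
  then have lead: "\<forall>j\<le>d. m < j \<longrightarrow> act (Es j) (v m) = 0" "act (Es m) (v m) \<noteq> 0"
    using split_vector_leading[of m] by auto
  obtain a where a: "act (Es m) x = vscale a (act (Es m) (v m))"
    using rank_one_span[OF res _ lead(2)] Suc.prems(1) by fastforce
  have "act (Es k) (x - vscale a (v m)) = 0" if "k \<le> d" "m \<le> k" for k
  proof (cases "k = m")
    case True
    then show ?thesis by (simp add: a act_diff_right act_vscale)
  next
    case False
    then show ?thesis
      using that lead(1) Suc.prems(2)[of k] by (simp add: act_diff_right act_vscale)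
  qed
  then obtain c where "x - vscale a (v m) = (\<Sum>k<m. vscale (c k) (v k))"
    using Suc.IH[of "x - vscale a (v m)"] Suc.prems(1) by auto
  then have "x = (\<Sum>k<Suc m. vscale ((c(m := a)) k) (v k))"
    by (simp add: diff_eq_eq)
  then show ?case by blast
qed

lemma act_idempotent_split_vector:
  assumes "j \<le> d"
  shows "act (E j) (v i) = vscale (\<Prod>h<i. \<theta> j - \<theta> h) (act (E j) y)"
  by (simp add: v_def idempotent_ascending_product[OF spec assms] act_scale flip: act_mult)

lemma act_idempotent_split_vector_eq_0: "j \<le> d \<Longrightarrow> j < i \<Longrightarrow> act (E j) (v i) = 0"
  by (subst act_idempotent_split_vector) auto

text \<open>This is cyclicity of \<open>y\<close>: each \<open>act (E j) (v k)\<close> is a multiple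
  of \<open>act (E j) y\<close>, so if the latter were zero, \<open>E j\<close> would kill a
  spanning set.\<close>

lemma act_idempotent_end_vector:
  assumes "j \<le> d"
  shows "act (E j) y \<noteq> 0"
proof
  assume 0: "act (E j) y = 0"
  have "act (E j) x = 0" for x
  proof -
    obtain c where "x = (\<Sum>k<d + 1. vscale (c k) (v k))"
      using split_vectors_span[of "d + 1" x] by auto
    then show ?thesis
      by (simp add: act_sum_right act_vscale act_add_right act_idempotent_split_vector[OF assms] 0)
  qed
  then have "E j = 0" by (rule faithful)
  then show False using res_E assms by (simp add: rank_one_resolution_def)
qed

lemma act_idempotent_split_vector_diag:
  assumes "i \<le> d"
  shows "act (E i) (v i) \<noteq> 0"
proof -
  have "\<theta> i \<noteq> \<theta> h" if "h < i" for h
    using spec inj_onD[of \<theta> "{..d}" i h] that assms by (auto simp: spectral_resolution_def)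
  then show ?thesis
    using assms act_idempotent_end_vector[OF assms] by (simp add: act_idempotent_split_vector)
qed

text \<open>Forward substitution: \<open>E j\<close> kills \<open>v k\<close> for k > j, and the
  coefficients below j are already zero, so only the diagonal term remains.\<close>

lemma split_vectors_coefficients:
  assumes m: "m \<le> d + 1"
    and z: "\<And>j. j < m \<Longrightarrow> act (E j) (\<Sum>k<m. vscale (c k) (v k)) = 0"
  shows "j < m \<Longrightarrow> c j = 0"
proof (induction j rule: less_induct)
  case (less j)
  then have "j \<le> d" using m by simp
  have "0 = (\<Sum>k<m. vscale (c k) (act (E j) (v k)))"
    using z[OF less.prems] by (simp add: act_sum_right act_vscale)
  also have "\<dots> = (\<Sum>k\<in>{j}. vscale (c k) (act (E j) (v k)))"
  proof (rule sum.mono_neutral_right)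
    show "\<forall>k\<in>{..<m} - {j}. vscale (c k) (act (E j) (v k)) = 0"
    proof
      fix k assume "k \<in> {..<m} - {j}"
      then show "vscale (c k) (act (E j) (v k)) = 0"
        using less.IH[of k] act_idempotent_split_vector_eq_0[OF \<open>j \<le> d\<close>, of k]
        by (cases "k < j") auto
    qed
  qed (use less in auto)
  finally show ?case
    using act_idempotent_split_vector_diag[OF \<open>j \<le> d\<close>] by simp
qed

text \<open>For \<open>z\<close> in the intersection, subtract the multiple of \<open>v i\<close>
  that cancels its \<open>Es i\<close> component. The difference is a combination of the earlier
  \<open>v k\<close> by the first triangular shape, and all coefficients vanish by the
  second.\<close>

lemma split_basis:
  "attached_basis v (\<lambda>i. idempotent_sum act Es 0 i \<inter> idempotent_sum act E i d)"
  unfolding attached_basis_def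
proof (intro conjI allI impI)
  show "is_basis_sequence vscale d v"
  proof (rule is_basis_sequenceI)
    fix c assume "(\<Sum>i\<le>d. vscale (c i) (v i)) = 0"
    then show "\<forall>i\<le>d. c i = 0"
      using split_vectors_coefficients[of "d + 1" c] by (auto simp: lessThan_Suc_atMost)
  next
    fix x
    obtain c where "x = (\<Sum>k\<le>d. vscale (c k) (v k))"
      using split_vectors_span[of "d + 1" x] by (auto simp: lessThan_Suc_atMost)
    then show "x \<in> V.span (v ` {..d})"
      by (simp only:) (intro V.span_sum V.span_scale V.span_base; simp)
  qed
next
  fix i assume i: "i \<le> d"
  let ?W = "idempotent_sum act Es 0 i \<inter> idempotent_sum act E i d"
  have W: "x \<in> ?W \<longleftrightarrow> (\<forall>k\<le>d. i < k \<longrightarrow> act (Es k) x = 0) \<and> (\<forall>k\<le>d. k < i \<longrightarrow> act (E k) x = 0)"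
    for x
    using i by (auto simp: mem_idempotent_sum[OF res] mem_idempotent_sum[OF res_E])
  note lead = split_vector_leading[OF i]
  show "is_basis_of vscale {v i} ?W"
  proof (rule singleton_is_basis_of)
    show "v i \<noteq> 0" using lead by auto
    show "vscale c (v i) \<in> ?W" for c
      unfolding W using lead act_idempotent_split_vector_eq_0 by (simp add: act_vscale)
  next
    fix z assume "z \<in> ?W"
    note z = this[unfolded W]
    obtain a where a: "act (Es i) z = vscale a (act (Es i) (v i))"
      using rank_one_span[OF res i] lead by blast
    have "act (Es k) (z - vscale a (v i)) = 0" if "k \<le> d" "i \<le> k" for k
      using that lead a z by (cases "k = i") (auto simp: act_diff_right act_vscale)
    then obtain c where c: "z - vscale a (v i) = (\<Sum>k<i. vscale (c k) (v k))"
      using split_vectors_span[of i] i by auto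
    have "act (E j) (z - vscale a (v i)) = 0" if "j < i" for j
      using that z i act_idempotent_split_vector_eq_0[of j i]
      by (auto simp: act_diff_right act_vscale)
    then have "c j = 0" if "j < i" for j
      using split_vectors_coefficients[of i c j] that i c by simp
    then have "z = vscale a (v i)" using c by simp
    then show "\<exists>c. z = vscale c (v i)" by blast
  qed
qed

text \<open>Since no component of \<open>y\<close> vanishes, each one generates its line, and the
  lines decompose the module.\<close>

lemma eigenspace_basis: "attached_basis (\<lambda>i. act (E i) y) (\<lambda>i. range (act (E i)))"
  unfolding attached_basis_def
proof (intro conjI allI impI)
  fix i assume i: "i \<le> d"
  show "is_basis_of vscale {act (E i) y} (range (act (E i)))"
  proof (rule singleton_is_basis_of)
    show "act (E i) y \<noteq> 0" by (rule act_idempotent_end_vector[OF i])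
    show "vscale c (act (E i) y) \<in> range (act (E i))" for c
      by (metis act_vscale rangeI)
    show "z \<in> range (act (E i)) \<Longrightarrow> \<exists>c. z = vscale c (act (E i) y)" for z
      using rank_one_span[OF res_E i act_idempotent_end_vector[OF i]] by blast
  qed
next
  show "is_basis_sequence vscale d (\<lambda>i. act (E i) y)"
  proof (rule is_basis_sequenceI)
    fix c assume 0: "(\<Sum>i\<le>d. vscale (c i) (act (E i) y)) = 0"
    show "\<forall>j\<le>d. c j = 0"
    proof (intro allI impI)
      fix j assume j: "j \<le> d"
      have "act (E j) (act (E i) y) = (if i = j then act (E j) y else 0)" if "i \<le> d" for i
        using res_E that j by (auto simp: rank_one_resolution_def simp flip: act_mult)
      then have "(\<Sum>i\<le>d. if i = j then vscale (c j) (act (E j) y) else 0) =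
          act (E j) (\<Sum>i\<le>d. vscale (c i) (act (E i) y))"
        unfolding act_sum_right by (intro sum.cong) (auto simp: act_vscale)
      then show "c j = 0"
        using 0 j act_idempotent_end_vector[OF j] by simp
    qed
  next
    fix x
    have "\<forall>i. \<exists>c. i \<le> d \<longrightarrow> act (E i) x = vscale c (act (E i) y)"
      using rank_one_span[OF res_E _ act_idempotent_end_vector] by metis
    then obtain c where c: "\<And>i. i \<le> d \<Longrightarrow> act (E i) x = vscale (c i) (act (E i) y)"
      by metis
    then have "x = (\<Sum>i\<le>d. vscale (c i) (act (E i) y))"
      using resolution_sum[OF res_E, of x] by simp
    then show "x \<in> V.span ((\<lambda>i. act (E i) y) ` {..d})"
      by (simp only:) (intro V.span_sum V.span_scale V.span_base; simp)
  qed
qed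

end

section \<open>Reversing the order of the idempotents\<close>

lemma sum_reverse: "(\<Sum>i\<le>d. f (d - i)) = (\<Sum>i\<le>d. f i :: 'b::comm_monoid_add)"
  by (rule sum.reindex_bij_witness[of _ "\<lambda>i. d - i" "\<lambda>i. d - i"]) auto

lemma rank_one_resolution_reverse:
  assumes "rank_one_resolution E"
  shows "rank_one_resolution (\<lambda>i. E (d - i))"
  using assms by (auto simp: rank_one_resolution_def sum_reverse)

lemma spectral_resolution_reverse:
  assumes "spectral_resolution X E \<theta>"
  shows "spectral_resolution X (\<lambda>i. E (d - i)) (\<lambda>i. \<theta> (d - i))"
proof -
  have "inj_on (\<lambda>i. \<theta> (d - i)) {..d}"
  proof (rule inj_onI)
    fix i j assume ij: "i \<in> {..d}" "j \<in> {..d}" "\<theta> (d - i) = \<theta> (d - j)"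
    then have "d - i = d - j"
      using assms inj_onD[of \<theta> "{..d}" "d - i" "d - j"] by (simp add: spectral_resolution_def)
    then show "i = j" using ij by simp
  qed
  then show ?thesis
    using assms rank_one_resolution_reverse[of E] by (simp add: spectral_resolution_def)
qed

lemma tridiagonal_products_reverse:
  assumes "tridiagonal_products d X E"
  shows "tridiagonal_products d X (\<lambda>i. E (d - i))"
  unfolding tridiagonal_products_def
proof (intro allI impI)
  fix i j assume ij: "i \<le> d" "j \<le> d"
  have "\<bar>int (d - i) - int (d - j)\<bar> = \<bar>int i - int j\<bar>"
    using ij by (simp add: of_nat_diff)
  then show "(1 < \<bar>int i - int j\<bar> \<longrightarrow> E (d - i) * X * E (d - j) = 0) \<and>
      (\<bar>int i - int j\<bar> = 1 \<longrightarrow> E (d - i) * X * E (d - j) \<noteq> 0)"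
    using assms by (metis diff_le_self tridiagonal_products_def)
qed

lemma idempotent_sum_reverse:
  assumes "m \<le> d" "n \<le> d"
  shows "idempotent_sum act (\<lambda>i. E (d - i)) m n = idempotent_sum act E (d - n) (d - m)"
  unfolding idempotent_sum_def
  by (rule sum.reindex_bij_witness[of _ "\<lambda>i. d - i" "\<lambda>i. d - i"]) (use assms in auto)

text \<open>Both lists of factors run through the indices d, d - 1, ..., d - m + 1 in this
  order.\<close>

lemma ascending_product_reverse:
  assumes "m \<le> d"
  shows "ascending_product scale X (\<lambda>i. t (d - i)) m = descending_product d scale X t (d - m)"
proof -
  have "map (\<lambda>i. d - i) [0..<m] = rev [d - m + 1..<d + 1]"
    by (rule nth_equalityI) (use assms in \<open>auto simp: rev_nth simp del: upt_Suc\<close>)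
  then have "map (\<lambda>i. X - scale (t (d - i)) 1) [0..<m] =
      map (\<lambda>h. X - scale (t h) 1) (rev [d - m + 1..<d + 1])"
    by (metis (no_types, lifting) list.map_comp map_eq_conv comp_def)
  then show ?thesis
    by (simp only: ascending_product_def descending_product_def)
qed

text \<open>Reversing \<open>E\<close>, \<open>Es\<close>, both or neither turns
  \<open>split_basis\<close> into four bases, and reversing each basis gives eight. The components
  of the two end vectors give the other four. Exchanging the two families will double the
  twelve.\<close>

lemma attached_bases:
  assumes spec: "spectral_resolution A E \<theta>"
    and res: "rank_one_resolution Es"
    and tri: "tridiagonal_products d A Es"
    and y0: "y0 \<noteq> 0" "y0 \<in> range (act (Es 0))"
    and yd: "yd \<noteq> 0" "yd \<in> range (act (Es d))"
  defines "S \<equiv> idempotent_sum act E" and "Ss \<equiv> idempotent_sum act Es"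
    and "up \<equiv> ascending_product scale A \<theta>" and "down \<equiv> descending_product d scale A \<theta>"
  shows "attached_basis (\<lambda>i. act (up i) y0) (\<lambda>i. Ss 0 i \<inter> S i d)"
    and "attached_basis (\<lambda>i. act (up (d - i)) y0) (\<lambda>i. Ss 0 (d - i) \<inter> S (d - i) d)"
    and "attached_basis (\<lambda>i. act (up i) yd) (\<lambda>i. Ss (d - i) d \<inter> S i d)"
    and "attached_basis (\<lambda>i. act (up (d - i)) yd) (\<lambda>i. Ss i d \<inter> S (d - i) d)"
    and "attached_basis (\<lambda>i. act (down i) y0) (\<lambda>i. Ss 0 (d - i) \<inter> S 0 i)"
    and "attached_basis (\<lambda>i. act (down (d - i)) y0) (\<lambda>i. Ss 0 i \<inter> S 0 (d - i))"
    and "attached_basis (\<lambda>i. act (down i) yd) (\<lambda>i. Ss i d \<inter> S 0 i)"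
    and "attached_basis (\<lambda>i. act (down (d - i)) yd) (\<lambda>i. Ss (d - i) d \<inter> S 0 (d - i))"
    and "attached_basis (\<lambda>i. act (E i) y0) (\<lambda>i. range (act (E i)))"
    and "attached_basis (\<lambda>i. act (E (d - i)) y0) (\<lambda>i. range (act (E (d - i))))"
    and "attached_basis (\<lambda>i. act (E i) yd) (\<lambda>i. range (act (E i)))"
    and "attached_basis (\<lambda>i. act (E (d - i)) yd) (\<lambda>i. range (act (E (d - i))))"
proof -
  note spec' = spectral_resolution_reverse[OF spec]
  note res' = rank_one_resolution_reverse[OF res]
  note tri' = tridiagonal_products_reverse[OF tri]
  \<comment> \<open>In this form \<open>yd\<close> belongs to member 0 of the reversed
    family.\<close>
  have yd': "yd \<in> range (act (Es (d - 0)))" using yd by simp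
  note reverse = idempotent_sum_reverse ascending_product_reverse S_def Ss_def up_def down_def
  show 1: "attached_basis (\<lambda>i. act (up i) y0) (\<lambda>i. Ss 0 i \<inter> S i d)"
    by (rule attached_basis_cong[OF split_basis[OF spec res tri y0]]) (simp_all add: reverse)
  show 2: "attached_basis (\<lambda>i. act (up i) yd) (\<lambda>i. Ss (d - i) d \<inter> S i d)"
    by (rule attached_basis_cong[OF split_basis[OF spec res' tri' yd(1) yd']])
      (simp_all add: reverse)
  show 3: "attached_basis (\<lambda>i. act (down (d - i)) y0) (\<lambda>i. Ss 0 i \<inter> S 0 (d - i))"
    by (rule attached_basis_cong[OF split_basis[OF spec' res tri y0]]) (simp_all add: reverse)
  show 4: "attached_basis (\<lambda>i. act (down (d - i)) yd) (\<lambda>i. Ss (d - i) d \<inter> S 0 (d - i))"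
    by (rule attached_basis_cong[OF split_basis[OF spec' res' tri' yd(1) yd']])
      (simp_all add: reverse)
  show "attached_basis (\<lambda>i. act (up (d - i)) y0) (\<lambda>i. Ss 0 (d - i) \<inter> S (d - i) d)"
    by (rule attached_basis_reverse[OF 1])
  show "attached_basis (\<lambda>i. act (up (d - i)) yd) (\<lambda>i. Ss i d \<inter> S (d - i) d)"
    by (rule attached_basis_cong[OF attached_basis_reverse[OF 2]]) simp_all
  show "attached_basis (\<lambda>i. act (down i) y0) (\<lambda>i. Ss 0 (d - i) \<inter> S 0 i)"
    by (rule attached_basis_cong[OF attached_basis_reverse[OF 3]]) simp_all
  show "attached_basis (\<lambda>i. act (down i) yd) (\<lambda>i. Ss i d \<inter> S 0 i)"
    by (rule attached_basis_cong[OF attached_basis_reverse[OF 4]]) simp_all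
  show 5: "attached_basis (\<lambda>i. act (E i) y0) (\<lambda>i. range (act (E i)))"
    by (rule eigenspace_basis[OF spec res tri y0])
  show 6: "attached_basis (\<lambda>i. act (E i) yd) (\<lambda>i. range (act (E i)))"
    by (rule eigenspace_basis[OF spec res' tri' yd(1) yd'])
  show "attached_basis (\<lambda>i. act (E (d - i)) y0) (\<lambda>i. range (act (E (d - i))))"
    by (rule attached_basis_reverse[OF 5])
  show "attached_basis (\<lambda>i. act (E (d - i)) yd) (\<lambda>i. range (act (E (d - i))))"
    by (rule attached_basis_reverse[OF 6])
qed

end

text \<open>This guarantees that looking up an ordering by \<open>map_of\<close> succeeds; the cases
  run over the four distinct symbols.\<close>

lemma linear_ordering_in_basis_table:
  assumes "linear_ordering g"
  shows "g \<in> fst ` set (basis_table d scale act A E As Es \<theta> \<theta>s \<eta>0 \<eta>d \<eta>s0 \<eta>sd)"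
proof -
  have "length g = 4"
    using assms distinct_card[of g] by (simp add: linear_ordering_def)
  then obtain w x y z where g: "g = [w, x, y, z]"
    by (auto simp: numeral_eq_Suc length_Suc_conv)
  have dist: "distinct [w, x, y, z]"
    using assms by (simp add: linear_ordering_def g)
  show ?thesis
    unfolding g basis_table_def Let_def
    using dist by (cases w; cases x; simp; cases y; simp; cases z; simp)
qed

theorem theorem9p1:
  fixes d :: nat
    and scale :: "'k::field \<Rightarrow> 'a::ring_1 \<Rightarrow> 'a"
    and act :: "'a \<Rightarrow> 'v::ab_group_add \<Rightarrow> 'v"
    and A As :: 'a and E Es :: "nat \<Rightarrow> 'a"
    and \<theta> \<theta>s :: "nat \<Rightarrow> 'k"
    and \<eta>0 \<eta>d \<eta>s0 \<eta>sd :: 'v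
  assumes "full_matrix_algebra d scale"
    and "leonard_system d scale A E As Es"
    and "eigenvalue_sequence d scale A E \<theta>"
    and "eigenvalue_sequence d scale As Es \<theta>s"
    and "irreducible_left_module act"
    and "\<eta>0 \<noteq> 0" and "\<eta>0 \<in> range (act (E 0))"
    and "\<eta>d \<noteq> 0" and "\<eta>d \<in> range (act (E d))"
    and "\<eta>s0 \<noteq> 0" and "\<eta>s0 \<in> range (act (Es 0))"
    and "\<eta>sd \<noteq> 0" and "\<eta>sd \<in> range (act (Es d))"
  shows "\<forall>g. linear_ordering g \<longrightarrow>
    (\<exists>v W. map_of (basis_table d scale act A E As Es \<theta> \<theta>s \<eta>0 \<eta>d \<eta>s0 \<eta>sd) g = Some (v, W) \<and>
       (\<forall>i\<le>d. is_basis_of (induced_scale scale act) {v i} (W i)) \<and>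
       is_basis_sequence (induced_scale scale act) d v)"
proof -
  have "field_algebra scale" "left_module act"
    using assms(1,5) by (auto simp: full_matrix_algebra_def irreducible_left_module_def)
  then interpret irreducible_matrix_module scale act d
    using assms(1,5)
    by (simp add: irreducible_matrix_module_def irreducible_matrix_module_axioms_def
        algebra_module_def)
  have A: "spectral_resolution A E \<theta>" and As: "spectral_resolution As Es \<theta>s"
    using assms(2-4) primitive_idempotents_spectral_resolution
    by (auto simp: leonard_system_def)
  have tri: "tridiagonal_products d As E" "tridiagonal_products d A Es"
    using assms(2) by (auto simp: leonard_system_def)
  have res: "rank_one_resolution E" "rank_one_resolution Es"
    using A As by (auto simp: spectral_resolution_def)
  \<comment> \<open>Products and idempotents of \<open>A\<close> act on end vectors of the dual
    family, and those of \<open>As\<close> on end vectors of the family \<open>E\<close>.\<close>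
  note bases = attached_bases[OF A res(2) tri(2) assms(10-13)]
    attached_bases[OF As res(1) tri(1) assms(6-9)]
  let ?table = "basis_table d scale act A E As Es \<theta> \<theta>s \<eta>0 \<eta>d \<eta>s0 \<eta>sd"
  \<comment> \<open>The table lists some intersections in the opposite order, hence
    \<open>Int_commute\<close>.\<close>
  have "\<forall>(g, v, W) \<in> set ?table. attached_basis v W"
    using bases by (simp add: basis_table_def Let_def Int_commute)
  then have good: "attached_basis v W" if "(g, v, W) \<in> set ?table" for g v W
    using that by blast
  show ?thesis
  proof (intro allI impI)
    fix g assume "linear_ordering g"
    \<comment> \<open>Every row is already known to be correct, so it remains only to know that some
      row carries \<open>g\<close>.\<close>
    then have "map_of ?table g \<noteq> None"
      using linear_ordering_in_basis_table by (simp only: map_of_eq_None_iff not_not)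
    then obtain v W where vW: "map_of ?table g = Some (v, W)"
      by (metis not_None_eq surj_pair)
    show "\<exists>v W. map_of ?table g = Some (v, W) \<and>
       (\<forall>i\<le>d. is_basis_of vscale {v i} (W i)) \<and> is_basis_sequence vscale d v"
      using vW good[OF map_of_SomeD[OF vW]] unfolding attached_basis_def by blast
  qed
qed

end
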